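(* For all integers $n\geq k\geq 1$ there exists a cyclically $k$-diagonal globally simple non-zero sum Heffter array $\mathrm{NH}(n;k)$.
   Context: A partially filled (p.f.) array is a matrix in which some cells may be empty. For $n\ge k\ge 1$, a non-zero sum Heffter array $\mathrm{NH}(n;k)$ is an $n\times n$ p.f. array $A$ with entries in $\mathbb{Z}_{2nk+1}$ such that: (a) each row and each column contains exactly $k$ filled cells; (b) the multiset $\{\pm x \mid x\in A\}$ contains each element of $\mathbb{Z}_{2nk+1}\setminus\{0\}$ exactly once; (c) the sum of the elements in every row and in every column is different from $0$ in $\mathbb{Z}_{2nk+1}$. For a finite subset $T$ of an abelian group, an ordering $(t_1,\dots,t_k)$ of the elements of $T$ is simple if no proper nonempty subsequence of consecutive terms sums to $0$. When the total sum $t_1+\cdots+t_k$ is non-zero, this is equivalent to $0,s_1,\dots,s_k$ being pairwise distinct, where $s_i=\sum_{j=1}^i t_j$. The natural ordering of a row (resp. column) of $A$ is the ordering of its entries (skipping empty cells) from left to right (resp. from top to bottom). The array $A$ is globally simple if the natural ordering of each row and of each column is simple. For an $n\times n$ p.f. array, with row and column indices taken modulo $n$ in $\{1,\dots,n\}$, the $i$-th diagonal is $D_i=\{(i,1),(i+1,2),\ldots,(i-1,n)\}$. The diagonals $D_i,D_{i+1},\dots,D_{i+k-1}$ (indices modulo $n$) are called $k$ consecutive diagonals. A square p.f. array of size $n\ge k\ge 1$ is cyclically $k$-diagonal if its nonempty cells are exactly those of $k$ consecutive diagonals. *)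

theory Defs
  imports
    "HOL-Library.Multiset"
    "HOL-Library.Sublist"
    "HOL-Number_Theory.Cong"
begin

type_synonym 'a pf_array = "nat \<Rightarrow> nat \<Rightarrow> 'a option"

definition filled_cells :: "'a pf_array \<Rightarrow> (nat \<times> nat) set" where
  "filled_cells A = {(i, j). A i j \<noteq> None}"

text \<open>Rows and columns are numbered from 1 to \<open>n\<close>; there are no entries outside this range.\<close>

definition square_pf_array :: "nat \<Rightarrow> 'a pf_array \<Rightarrow> bool" where
  "square_pf_array n A \<longleftrightarrow> filled_cells A \<subseteq> {1..n} \<times> {1..n}"

definition row_entries :: "nat \<Rightarrow> 'a pf_array \<Rightarrow> nat \<Rightarrow> 'a list" where
  "row_entries n A i = List.map_filter (\<lambda>j. A i j) [1..<n + 1]"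

definition col_entries :: "nat \<Rightarrow> 'a pf_array \<Rightarrow> nat \<Rightarrow> 'a list" where
  "col_entries n A j = List.map_filter (\<lambda>i. A i j) [1..<n + 1]"

text \<open>
  The elements of \<open>\<int>\<^sub>v\<close> are represented by the integers in \<open>{0..<v}\<close>, and equality in \<open>\<int>\<^sub>v\<close> of
  sums of such elements is congruence modulo \<open>v\<close>.
\<close>

definition heffter_modulus :: "nat \<Rightarrow> nat \<Rightarrow> int" where
  "heffter_modulus n k = 2 * int n * int k + 1"

definition pm_entries :: "int \<Rightarrow> int pf_array \<Rightarrow> int multiset" where
  "pm_entries v A = (\<Sum>(i, j)\<in>filled_cells A. {#the (A i j), (- the (A i j)) mod v#})"

definition nonzero_sum_heffter :: "nat \<Rightarrow> nat \<Rightarrow> int pf_array \<Rightarrow> bool" where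
  "nonzero_sum_heffter n k A \<longleftrightarrow>
     square_pf_array n A \<and>
     (\<forall>(i, j)\<in>filled_cells A. the (A i j) \<in> {0..<heffter_modulus n k}) \<and>
     (\<forall>i\<in>{1..n}. card {j\<in>{1..n}. A i j \<noteq> None} = k) \<and>
     (\<forall>j\<in>{1..n}. card {i\<in>{1..n}. A i j \<noteq> None} = k) \<and>
     (\<forall>x\<in>{0..<heffter_modulus n k} - {0}. count (pm_entries (heffter_modulus n k) A) x = 1) \<and>
     (\<forall>i\<in>{1..n}. [sum_list (row_entries n A i) \<noteq> 0] (mod heffter_modulus n k)) \<and>
     (\<forall>j\<in>{1..n}. [sum_list (col_entries n A j) \<noteq> 0] (mod heffter_modulus n k))"

text \<open>In \<^theory>\<open>HOL-Library.Sublist\<close>, a sublist is a block of consecutive terms.\<close>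

definition simple_ordering :: "int \<Rightarrow> int list \<Rightarrow> bool" where
  "simple_ordering v ts \<longleftrightarrow>
     (\<forall>us. strict_sublist us ts \<and> us \<noteq> [] \<longrightarrow> [sum_list us \<noteq> 0] (mod v))"

definition globally_simple :: "int \<Rightarrow> nat \<Rightarrow> int pf_array \<Rightarrow> bool" where
  "globally_simple v n A \<longleftrightarrow>
     (\<forall>i\<in>{1..n}. simple_ordering v (row_entries n A i)) \<and>
     (\<forall>j\<in>{1..n}. simple_ordering v (col_entries n A j))"

text \<open>The representative in \<open>{1..n}\<close> of the index \<open>m\<close> modulo \<open>n\<close>, for \<open>m \<ge> 1\<close>.\<close>

definition wrap_index :: "nat \<Rightarrow> nat \<Rightarrow> nat" where
  "wrap_index n m = (m - 1) mod n + 1"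

definition diagonal :: "nat \<Rightarrow> nat \<Rightarrow> (nat \<times> nat) set" where
  "diagonal n i = (\<lambda>j. (wrap_index n (i + j - 1), j)) ` {1..n}"

definition cyclically_diagonal :: "nat \<Rightarrow> nat \<Rightarrow> 'a pf_array \<Rightarrow> bool" where
  "cyclically_diagonal n k A \<longleftrightarrow>
     square_pf_array n A \<and>
     (\<exists>i\<in>{1..n}. filled_cells A = (\<Union>l<k. diagonal n (wrap_index n (i + l))))"

end

theory Submission
  imports Defs
begin

text \<open>
  Let \<open>l = i - j\<close> modulo \<open>n\<close> index the diagonals and put \<open>(-1)\<^sup>l (l n + i)\<close> in cell \<open>(i, j)\<close> for
  \<open>0 \<le> l < k\<close>, where for odd \<open>k\<close> the row number \<open>i\<close> on the diagonal \<open>l = 0\<close> is replaced by its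
  cyclic successor. The absolute values run over \<open>1, \<dots>, n k\<close>. A row or column is, up to reversal,
  the sequence \<open>l = c, \<dots>, k - 1, 0, \<dots>, c - 1\<close>, whose two runs alternate in sign and increase in
  absolute value, so a block within a run has a non-zero sum of absolute value at most \<open>n k\<close>.
  A block meeting both runs has a sum of absolute value at most \<open>2 n k\<close>, and it remains to see that
  it is non-zero as an integer.
\<close>

section \<open>Alternating sums of increasing sequences and of progressions\<close>

definition alt_sum :: "(nat \<Rightarrow> int) \<Rightarrow> nat \<Rightarrow> nat \<Rightarrow> int" where
  "alt_sum x a b = (\<Sum>l\<in>{a..<b}. (-1) ^ l * x l)"

lemma alt_sum_Suc: "a \<le> b \<Longrightarrow> alt_sum x a (Suc b) = alt_sum x a b + (-1) ^ b * x b"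
  by (simp add: alt_sum_def)

text \<open>The last term dominates: appending \<open>x b\<close> to a sum that is, up to sign,
  positive and at most \<open>x (b - 1)\<close> gives, up to sign, \<open>x b\<close> minus a
  positive amount smaller than \<open>x b\<close>.\<close>

lemma alt_sum_sign_bound:
  assumes "\<And>l. l < k \<Longrightarrow> 0 < x l" and "\<And>l. Suc l < k \<Longrightarrow> x l < x (Suc l)"
    and "a < b" and "b \<le> k"
  shows "0 < (-1) ^ (b - 1) * alt_sum x a b \<and> (-1) ^ (b - 1) * alt_sum x a b \<le> x (b - 1)"
proof -
  have "Suc a \<le> b"
    using assms(3) by simp
  then show ?thesis
    using assms(4)
  proof (induction b rule: dec_induct)
    case base
    have "(-1::int) ^ a * (-1) ^ a = 1"
      by (simp flip: power_add)
    then show ?case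
      using assms(1)[of a] base by (simp add: alt_sum_def flip: mult.assoc)
  next
    case (step b)
    then obtain b' where b: "b = Suc b'"
      by (cases b) auto
    have "(-1::int) ^ b * (-1) ^ b = 1"
      by (simp flip: power_add)
    then have "(-1) ^ b * alt_sum x a (Suc b) = x b - (-1) ^ (b - 1) * alt_sum x a b"
      using step(1) by (simp add: alt_sum_Suc b algebra_simps)
    moreover have "x b' < x b"
      using assms(2)[of b'] step b by simp
    ultimately show ?case
      using step b by auto
  qed
qed

text \<open>In each pair of consecutive terms \<open>u\<close> cancels, and what remains is
  \<open>- ((-1) ^ a) * N\<close>, since every pair starts at an index of the parity of
  \<open>a\<close>.\<close>

lemma alt_sum_linear_even:
  assumes "\<And>l. a \<le> l \<Longrightarrow> l < a + 2 * m \<Longrightarrow> x l = int l * N + u"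
  shows "alt_sum x a (a + 2 * m) = - ((-1) ^ a) * int m * N"
  using assms
proof (induction m)
  case 0
  then show ?case
    by (simp add: alt_sum_def)
next
  case (Suc m)
  have "alt_sum x a (a + 2 * m) = - ((-1) ^ a) * int m * N"
    using Suc by simp
  then show ?case
    using Suc.prems[of "a + 2 * m"] Suc.prems[of "Suc (a + 2 * m)"]
    by (simp add: alt_sum_Suc power_add algebra_simps)
qed

text \<open>
  The row and column entries, read from a rotated starting diagonal \<open>c\<close>, follow a progression of
  slope \<open>N\<close> on each of the two runs, apart from the exceptional value \<open>t\<close> on diagonal \<open>0\<close>. If the
  two partial sums have equal signs they cannot cancel; otherwise their sum is a multiple of \<open>N\<close>
  plus a remainder that is either non-zero modulo \<open>N\<close> or too small to cancel the multiple.
\<close>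

lemma alt_sum_wrap_nonzero:
  assumes pos: "\<And>l. l < k \<Longrightarrow> 0 < x l" and mono: "\<And>l. Suc l < k \<Longrightarrow> x l < x (Suc l)"
    and x0: "x 0 = t"
    and low: "\<And>l. 0 < l \<Longrightarrow> l < c \<Longrightarrow> x l = int l * N + s"
    and high: "\<And>l. c \<le> l \<Longrightarrow> l < k \<Longrightarrow> x l = int l * N + u"
    and su: "0 \<le> s - u" "s - u < N" and ts: "\<bar>t - s\<bar> < N"
    and odd: "odd k \<Longrightarrow> t \<noteq> s" and even: "even k \<Longrightarrow> t = s \<and> s < N"
    and ab: "0 < b" "b \<le> c" "c \<le> a" "a < k"
  shows "alt_sum x a k + alt_sum x 0 b \<noteq> 0"
proof -
  have t: "0 < t"
    using pos[of 0] x0 ab by simp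
  have N: "0 < N"
    using ts by linarith
  have sgn_a: "0 < (-1) ^ (k - 1) * alt_sum x a k"
    using alt_sum_sign_bound[of k x a k] pos mono ab by simp
  have sgn_b: "0 < (-1) ^ (b - 1) * alt_sum x 0 b"
    using alt_sum_sign_bound[of k x 0 b] pos mono ab by simp
  \<comment> \<open>Term 0 is split off because it carries the exceptional value; the remaining
    \<open>p\<close> pairs start at odd indices, so each adds \<open>N\<close>.\<close>
  have head: "alt_sum x 0 (Suc (2 * p)) = int p * N + t" if "2 * p < c" for p
  proof -
    have "alt_sum x 0 (Suc (2 * p)) = alt_sum x 0 1 + alt_sum x 1 (1 + 2 * p)"
      unfolding alt_sum_def by (subst sum.atLeastLessThan_concat) auto
    also have "alt_sum x 1 (1 + 2 * p) = int p * N"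
      using alt_sum_linear_even[of 1 p x N s] low that by simp
    finally show ?thesis
      by (simp add: alt_sum_def x0)
  qed
  have tail_even: "alt_sum x a k = - ((-1) ^ k) * int m * N" if "k = a + 2 * m" for m
    using alt_sum_linear_even[of a m x N u] high that ab by (simp add: power_add)
  have tail_odd: "alt_sum x a k = (-1) ^ (k - 1) * ((int k - 1 - int m) * N + u)"
    if "k = Suc (a + 2 * m)" for m
  proof -
    have "alt_sum x a (a + 2 * m) = - ((-1) ^ a) * int m * N"
      using alt_sum_linear_even[of a m x N u] high that ab by simp
    moreover have "x (a + 2 * m) = int (a + 2 * m) * N + u"
      using high that ab by simp
    ultimately show ?thesis
      by (simp add: that alt_sum_Suc power_add algebra_simps)
  qed
  have multiple: "q * N + r \<noteq> 0" if "r \<noteq> 0" "\<bar>r\<bar> < N" for q r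
  proof
    assume "q * N + r = 0"
    then have "N dvd r"
      by (metis dvd_add_right_iff dvd_triv_right dvd_0_right)
    then show False
      using that zdvd_not_zless[of "\<bar>r\<bar>" N] by simp
  qed
  show ?thesis
  \<comment> \<open>The signs of the two sums are those of their last terms, at indices
    \<open>k - 1\<close> and \<open>b - 1\<close>.\<close>
  proof (cases "even k = even b")
    case True
    then have "(-1::int) ^ (k - 1) = (-1) ^ (b - 1)"
      using ab by (simp add: minus_one_power_iff)
    then show ?thesis
      using sgn_a sgn_b by (auto simp: minus_one_power_iff split: if_splits)
  next
    case False
    obtain m where "k - a = 2 * m \<or> k - a = Suc (2 * m)"
      by (rule that[of "(k - a) div 2"]) presburger
    then have m: "k = a + 2 * m \<or> k = Suc (a + 2 * m)"
      using ab by auto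
    show ?thesis
    proof (cases "even k")
      case True
      then obtain p where p: "b = Suc (2 * p)"
        using False by (metis oddE Suc_eq_plus1)
      then have hd: "alt_sum x 0 b = int p * N + s"
        using head ab True even by simp
      show ?thesis
        using m
      proof
        assume k: "k = a + 2 * m"
        have "alt_sum x a k + alt_sum x 0 b = (int p - int m) * N + s"
          using hd tail_even[OF k] True by (simp add: algebra_simps)
        then show ?thesis
          using multiple[of s] t even True by simp
      next
        assume k: "k = Suc (a + 2 * m)"
        have "alt_sum x a k + alt_sum x 0 b = (int p + int m + 1 - int k) * N + (s - u)"
          using hd tail_odd[OF k] True ab by (simp add: algebra_simps)
        \<comment> \<open>The coefficient is negative because \<open>2 * p + 1 = b\<close>,
          \<open>b \<le> a\<close> and \<open>k = a + 2 * m + 1\<close>; the remainder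
          \<open>s - u < N\<close> cannot make up for it.\<close>
        moreover have "int p + int m + 1 - int k \<le> -1"
          using k p ab by simp
        then have "(int p + int m + 1 - int k) * N \<le> -1 * N"
          using N by (intro mult_right_mono) auto
        ultimately show ?thesis
          using su by linarith
      qed
    next
      case False': False
      then obtain p' where "b = 2 * p'"
        using False by auto
      then obtain p where p: "b = Suc (Suc (2 * p))"
        using ab by (cases p') auto
      have "alt_sum x 0 b = int p * N + t - x (Suc (2 * p))"
        using p head ab by (simp add: alt_sum_Suc)
      then have hd: "alt_sum x 0 b = t - s - (int p + 1) * N"
        using low[of "Suc (2 * p)"] p ab by (simp add: algebra_simps)
      show ?thesis
        using m
      proof
        assume k: "k = a + 2 * m"
        \<comment> \<open>The coefficient of \<open>N\<close> can vanish here, and then only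
          \<open>t \<noteq> s\<close> keeps the sum from being 0.\<close>
        have "alt_sum x a k + alt_sum x 0 b = (int m - int p - 1) * N + (t - s)"
          using hd tail_even[OF k] False' by (simp add: algebra_simps)
        then show ?thesis
          using multiple[of "t - s"] ts odd[OF False'] by simp
      next
        assume k: "k = Suc (a + 2 * m)"
        have "alt_sum x a k + alt_sum x 0 b = (int k - int m - int p - 2) * N + (u + t - s)"
          using hd tail_odd[OF k] False' ab by (simp add: algebra_simps)
        \<comment> \<open>With a positive coefficient, which follows from
          \<open>2 * p + 2 = b\<close> and \<open>b \<le> a\<close>, the sum is at least
          \<open>N - (s - u) + t\<close>, hence positive.\<close>
        moreover have "1 \<le> int k - int m - int p - 2"
          using k p ab by simp
        then have "1 * N \<le> (int k - int m - int p - 2) * N"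
          using N by (intro mult_right_mono) auto
        ultimately show ?thesis
          using su t by linarith
      qed
    qed
  qed
qed

section \<open>Blocks of a rotated alternating list and their residues\<close>

lemma sublist_map_upt:
  assumes "sublist us (map f [p..<q])"
  obtains a b where "p \<le> a" "b \<le> q" "us = map f [a..<b]"
proof -
  obtain us' where us: "sublist us' [p..<q]" "us = map f us'"
    using sublist_map_rightE[OF assms] by blast
  then obtain ps ss where split: "[p..<q] = ps @ us' @ ss"
    by (auto simp: sublist_def)
  have "us' = take (length us') (drop (length ps) [p..<q])"
    by (simp add: split)
  also have "\<dots> = [p + length ps..<min q (p + length ps + length us')]"
    by (auto simp: drop_upt take_upt min_def nat_le_linear
        intro!: take_upt take_all)
  finally show ?thesis
    using us(2) by (intro that[of "p + length ps" "min q (p + length ps + length us')"]) simp_all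
qed

text \<open>A block inside one run is controlled by its last term. A block across the junction is a
  tail of the first run followed by a head of the second, the situation of \<open>wrap\<close>. For
  \<open>M = n * k\<close> the bound \<open>2 * M\<close> is one less than the modulus.\<close>

lemma sum_list_rotated_alternating:
  fixes x :: "nat \<Rightarrow> int" and M :: int
  assumes pos: "\<And>l. l < k \<Longrightarrow> 0 < x l" and mono: "\<And>l. Suc l < k \<Longrightarrow> x l < x (Suc l)"
    and le: "\<And>l. l < k \<Longrightarrow> x l \<le> M"
    and wrap: "\<And>a b. 0 < b \<Longrightarrow> b \<le> c \<Longrightarrow> c \<le> a \<Longrightarrow> a < k \<Longrightarrow> alt_sum x a k + alt_sum x 0 b \<noteq> 0"
    and "c \<le> k"
    and us: "sublist us (map (\<lambda>l. (-1) ^ l * x l) ([c..<k] @ [0..<c]))" "us \<noteq> []"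
  shows "sum_list us \<noteq> 0 \<and> \<bar>sum_list us\<bar> \<le> 2 * M"
proof -
  let ?w = "\<lambda>l. (-1) ^ l * x l"
  have sum: "sum_list (map ?w [a..<b]) = alt_sum x a b" for a b
    by (simp add: alt_sum_def interv_sum_list_conv_sum_set_nat)
  have run: "alt_sum x a b \<noteq> 0 \<and> \<bar>alt_sum x a b\<bar> \<le> M" if "a < b" "b \<le> k" for a b
  proof -
    have "0 < (-1) ^ (b - 1) * alt_sum x a b \<and> (-1) ^ (b - 1) * alt_sum x a b \<le> x (b - 1)"
      using alt_sum_sign_bound[of k x a b] pos mono that by blast
    moreover have "x (b - 1) \<le> M"
      using le that by simp
    ultimately show ?thesis
      by (auto simp: minus_one_power_iff split: if_splits)
  qed
  have block: "sum_list vs \<noteq> 0 \<and> \<bar>sum_list vs\<bar> \<le> M"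
    if vs: "sublist vs (map ?w [p..<q])" "vs \<noteq> []" and "q \<le> k" for vs p q
  proof -
    obtain a b where ab: "p \<le> a" "b \<le> q" "vs = map ?w [a..<b]"
      using sublist_map_upt[OF vs(1)] .
    then have "a < b"
      using vs(2) by (cases "a < b") auto
    then show ?thesis
      using ab that(3) run[of a b] by (simp only: sum) simp
  qed
  \<comment> \<open>A straddling block with an empty half lies within one run, so in the third case
    both halves can be taken non-empty.\<close>
  consider "sublist us (map ?w [c..<k])" | "sublist us (map ?w [0..<c])"
    | us1 us2 where "us = us1 @ us2" "suffix us1 (map ?w [c..<k])" "prefix us2 (map ?w [0..<c])"
        "us1 \<noteq> []" "us2 \<noteq> []"
    using us(1) unfolding map_append sublist_append
    by (metis append_Nil append_Nil2 prefix_imp_sublist suffix_imp_sublist)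
  then show ?thesis
  proof cases
    case 1
    then show ?thesis
      using block[OF 1 us(2)] by linarith
  next
    case 2
    then show ?thesis
      using block[OF 2 us(2) \<open>c \<le> k\<close>] by linarith
  next
    case 3
    obtain ps where ps: "map ?w [c..<k] = ps @ us1"
      using 3(2) by (auto simp: suffix_def)
    have "us1 = drop (length ps) (map ?w [c..<k])"
      by (simp add: ps)
    then have us1: "us1 = map ?w [c + length ps..<k]"
      by (simp only: drop_map drop_upt)
    then have a: "c + length ps < k"
      using 3(4) by (cases "c + length ps < k") auto
    obtain ss where ss: "map ?w [0..<c] = us2 @ ss"
      using 3(3) by (auto simp: prefix_def)
    have "length us2 + length ss = c"
      using arg_cong[OF ss, of length] by simp
    moreover have "us2 = take (length us2) (map ?w [0..<c])"
      by (simp add: ss)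
    ultimately have us2: "us2 = map ?w [0..<length us2]" and b: "length us2 \<le> c"
      by (simp_all add: take_map)
    have "sum_list us = alt_sum x (c + length ps) k + alt_sum x 0 (length us2)"
      using 3(1) us1 us2 sum by (metis sum_list_append)
    moreover have "alt_sum x (c + length ps) k + alt_sum x 0 (length us2) \<noteq> 0"
      using wrap a b 3(5) by simp
    moreover have "\<bar>alt_sum x (c + length ps) k\<bar> \<le> M" "\<bar>alt_sum x 0 (length us2)\<bar> \<le> M"
      using run[of "c + length ps" k] run[of 0 "length us2"] a b 3(5) \<open>c \<le> k\<close> by simp_all
    ultimately show ?thesis
      by simp
  qed
qed

lemma sum_list_map_mod_cong: "[sum_list (map (\<lambda>y. y mod v) ys) = sum_list ys] (mod v)" for v :: int
  by (induction ys) (simp_all add: cong_add)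

text \<open>Reduction modulo \<open>v\<close> preserves block sums up to congruence, and a non-zero
  integer of absolute value below \<open>v\<close> is not divisible by \<open>v\<close>. The second
  claim is the case where the block is the whole list.\<close>

lemma simple_ordering_of_small_sums:
  assumes "\<And>us. sublist us ys \<Longrightarrow> us \<noteq> [] \<Longrightarrow> sum_list us \<noteq> 0 \<and> \<bar>sum_list us\<bar> < v"
  shows "simple_ordering v (map (\<lambda>y. y mod v) ys)"
    and "ys \<noteq> [] \<Longrightarrow> [sum_list (map (\<lambda>y. y mod v) ys) \<noteq> 0] (mod v)"
proof -
  have *: "[sum_list us \<noteq> 0] (mod v)" if us: "sublist us (map (\<lambda>y. y mod v) ys)" "us \<noteq> []" for us
  proof
    assume "[sum_list us = 0] (mod v)"
    moreover obtain us' where us': "sublist us' ys" "us = map (\<lambda>y. y mod v) us'"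
      using sublist_map_rightE[OF us(1)] by blast
    ultimately have "[sum_list us' = 0] (mod v)"
      using sum_list_map_mod_cong cong_trans cong_sym by blast
    then have "v dvd sum_list us'"
      by (simp add: cong_0_iff)
    moreover have "sum_list us' \<noteq> 0 \<and> \<bar>sum_list us'\<bar> < v"
      using assms us' us(2) by simp
    ultimately show False
      using zdvd_not_zless[of "\<bar>sum_list us'\<bar>" v] by simp
  qed
  show "simple_ordering v (map (\<lambda>y. y mod v) ys)"
    using * by (auto simp: simple_ordering_def strict_sublist_def)
  show "[sum_list (map (\<lambda>y. y mod v) ys) \<noteq> 0] (mod v)" if "ys \<noteq> []"
    using * that by simp
qed

section \<open>The array and the absolute values of its entries\<close>

text \<open>Indices start at 0: within the square, the cells of index \<open>l\<close> form diagonal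
  number \<open>l + 1\<close>.\<close>

definition diag_index :: "nat \<Rightarrow> nat \<Rightarrow> nat \<Rightarrow> nat" where
  "diag_index n i j = (if j \<le> i then i - j else i + n - j)"

text \<open>
  For odd \<open>k\<close> the first and last diagonals carry the same sign, and without the shift on the first
  one, blocks such as \<open>-, +, +, -\<close> across the wrap-around would sum to \<open>0\<close>.
\<close>

definition shift :: "nat \<Rightarrow> nat \<Rightarrow> nat \<Rightarrow> nat" where
  "shift n k i = (if even k then i else i mod n + 1)"

text \<open>The absolute value of the entry in row \<open>i\<close> on the diagonal of index
  \<open>l\<close>. Each diagonal has its own window of \<open>n\<close> integers, from
  \<open>l * n + 1\<close> to \<open>Suc l * n\<close>.\<close>

definition height :: "nat \<Rightarrow> nat \<Rightarrow> nat \<Rightarrow> nat \<Rightarrow> nat" where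
  "height n k l i = l * n + (if l = 0 then shift n k i else i)"

definition diag_array :: "nat \<Rightarrow> nat \<Rightarrow> int pf_array" where
  "diag_array n k i j =
     (if i \<in> {1..n} \<and> j \<in> {1..n} \<and> diag_index n i j < k
      then Some ((-1) ^ diag_index n i j * int (height n k (diag_index n i j) i)
             mod heffter_modulus n k)
      else None)"

lemma shift_range: "i \<in> {1..n} \<Longrightarrow> shift n k i \<in> {1..n}"
  by (auto simp: shift_def Suc_le_eq)

lemma shift_inj: "i \<in> {1..n} \<Longrightarrow> i' \<in> {1..n} \<Longrightarrow> shift n k i = shift n k i' \<Longrightarrow> i = i'"
  by (cases "i = n"; cases "i' = n") (auto simp: shift_def split: if_splits)

lemma shift_neq: "odd k \<Longrightarrow> 2 \<le> n \<Longrightarrow> i \<in> {1..n} \<Longrightarrow> shift n k i \<noteq> i"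
  by (cases "i = n") (auto simp: shift_def)

lemma shift_surj:
  assumes "r \<in> {1..n}"
  obtains i where "i \<in> {1..n}" "shift n k i = r"
proof (cases "even k \<or> r = 1")
  case True
  then show ?thesis
    \<comment> \<open>For odd \<open>k\<close> the value 1 is attained in the last row, where the
      successor wraps around.\<close>
    using assms that[of "if even k then r else n"] by (auto simp: shift_def)
next
  case False
  then have "r - 1 \<in> {1..n}" "shift n k (r - 1) = r"
    using assms by (auto simp: shift_def)
  then show ?thesis
    by (rule that)
qed

lemma height_bounds:
  assumes "i \<in> {1..n}"
  shows "l * n < height n k l i" "height n k l i \<le> Suc l * n"
  using assms shift_range[OF assms, of k] by (auto simp: height_def)

text \<open>The windows of successive diagonals are disjoint and ordered. Two different rows are
  allowed, as the row changes along a column.\<close>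

lemma height_mono:
  assumes "i \<in> {1..n}" "i' \<in> {1..n}"
  shows "height n k l i < height n k (Suc l) i'"
  using height_bounds(2)[OF assms(1)] height_bounds(1)[OF assms(2)] by (rule le_less_trans)

lemma height_le: "i \<in> {1..n} \<Longrightarrow> l < k \<Longrightarrow> height n k l i \<le> n * k"
  using height_bounds(2)[of i n k l] mult_le_mono1[of "Suc l" k n] by (simp add: mult.commute)

section \<open>Rows and columns as lists\<close>

lemma map_filter_append: "List.map_filter f (xs @ ys) = List.map_filter f xs @ List.map_filter f ys"
  by (simp add: List.map_filter_def)

lemma map_filter_None: "(\<And>x. x \<in> set xs \<Longrightarrow> f x = None) \<Longrightarrow> List.map_filter f xs = []"
  by (simp add: List.map_filter_def)

lemma map_filter_Some:
  "(\<And>x. x \<in> set xs \<Longrightarrow> f (g x) = Some (h x)) \<Longrightarrow> List.map_filter f (map g xs) = map h xs"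
  by (induction xs) auto

lemma upt_split: "a \<le> b \<Longrightarrow> b \<le> c \<Longrightarrow> [a..<c] = [a..<b] @ [b..<c]"
  using upt_add_eq_append[of a b "c - b"] by simp

lemma upt_split4:
  assumes "a \<le> b" "b \<le> c" "c \<le> d" "d \<le> e"
  shows "[a..<e] = [a..<b] @ [b..<c] @ [c..<d] @ [d..<e]"
  using assms upt_split[of a b e] upt_split[of b c e] upt_split[of c d e] by simp

text \<open>Along a row the column number falls as the diagonal index grows, hence the
  reversal.\<close>

lemma upt_map_diff: "b \<le> Suc s \<Longrightarrow> [Suc s - b..<Suc s - a] = map (\<lambda>l. s - l) (rev [a..<b])"
  by (rule nth_equalityI) (auto simp: rev_nth)

lemma upt_map_shift: "n \<le> j + a \<Longrightarrow> [j + a - n..<j + b - n] = map (\<lambda>l. j + l - n) [a..<b]"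
  by (rule nth_equalityI) auto

text \<open>From left to right, the cells up to the main diagonal have indices \<open>r - 1\<close>
  down to 0; after a gap, the last \<open>k - r\<close> columns hold the wrapped indices
  \<open>k - 1\<close> down to \<open>r\<close>.\<close>

lemma diag_array_row:
  assumes "i \<in> {1..n}" "k \<le> n"
  defines "r \<equiv> min i k"
  shows "row_entries n (diag_array n k) i =
    map (\<lambda>y. y mod heffter_modulus n k)
      (rev (map (\<lambda>l. (-1) ^ l * int (height n k l i)) ([r..<k] @ [0..<r])))"
proof -
  let ?f = "diag_array n k i"
  let ?h = "\<lambda>l. (-1) ^ l * int (height n k l i) mod heffter_modulus n k"
  \<comment> \<open>The first column of the wrapped cells, or \<open>n + 1\<close> if there are
    none.\<close>
  define q where "q = n + 1 - (k - r)"
  have "[1..<n + 1] = [1..<Suc i - r] @ [Suc i - r..<Suc i] @ [Suc i..<q] @ [q..<n + 1]"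
    using assms by (intro upt_split4) (auto simp: q_def)
  moreover have "List.map_filter ?f [1..<Suc i - r] = []"
    using assms by (intro map_filter_None) (auto simp: diag_array_def diag_index_def)
  moreover have "List.map_filter ?f [Suc i..<q] = []"
    using assms by (intro map_filter_None) (auto simp: diag_array_def diag_index_def q_def min_def
        split: if_splits)
  moreover have "List.map_filter ?f [Suc i - r..<Suc i] = map ?h (rev [0..<r])"
  proof -
    have "[Suc i - r..<Suc i] = map (\<lambda>l. i - l) (rev [0..<r])"
      using upt_map_diff[of r i 0] by (simp add: r_def)
    then show ?thesis
      using assms by (simp only:) (intro map_filter_Some, auto simp: diag_array_def diag_index_def)
  qed
  moreover have "List.map_filter ?f [q..<n + 1] = map ?h (rev [r..<k])"
  proof (cases "i < k")
    case True
    then have "[q..<n + 1] = map (\<lambda>l. n + i - l) (rev [r..<k])"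
      using upt_map_diff[of k "n + i" i] assms by (simp add: r_def q_def)
    then show ?thesis
      using assms True
      by (simp only:) (intro map_filter_Some, auto simp: diag_array_def diag_index_def)
  qed (simp add: r_def q_def)
  ultimately show ?thesis
    unfolding row_entries_def by (simp add: map_filter_append rev_map comp_def)
qed

text \<open>For \<open>l < n\<close>, the row in which column \<open>j\<close> meets the diagonal of
  index \<open>l\<close>; an inverse of \<open>diag_index\<close> in that column.\<close>

definition wrapped_row :: "nat \<Rightarrow> nat \<Rightarrow> nat \<Rightarrow> nat" where
  "wrapped_row n j l = (if j + l \<le> n then j + l else j + l - n)"

lemma wrapped_row_range: "j \<in> {1..n} \<Longrightarrow> l < n \<Longrightarrow> wrapped_row n j l \<in> {1..n}"
  by (auto simp: wrapped_row_def)

text \<open>From top to bottom, rows 1 to \<open>k - c\<close> hold the wrapped indices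
  \<open>c\<close> to \<open>k - 1\<close>, and rows \<open>j\<close> to \<open>j + c - 1\<close>
  hold 0 to \<open>c - 1\<close>. The indices increase within each run, so no reversal
  occurs.\<close>

lemma diag_array_col:
  assumes "j \<in> {1..n}" "k \<le> n"
  defines "c \<equiv> min (n + 1 - j) k"
  shows "col_entries n (diag_array n k) j =
    map (\<lambda>y. y mod heffter_modulus n k)
      (map (\<lambda>l. (-1) ^ l * int (height n k l (wrapped_row n j l))) ([c..<k] @ [0..<c]))"
proof -
  let ?f = "\<lambda>i. diag_array n k i j"
  let ?h = "\<lambda>l. (-1) ^ l * int (height n k l (wrapped_row n j l)) mod heffter_modulus n k"
  define q where "q = 1 + (k - c)"
  have "[1..<n + 1] = [1..<q] @ [q..<j] @ [j..<j + c] @ [j + c..<n + 1]"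
    using assms by (intro upt_split4) (auto simp: q_def)
  moreover have "List.map_filter ?f [q..<j] = []"
    using assms by (intro map_filter_None) (auto simp: diag_array_def diag_index_def q_def min_def
        split: if_splits)
  moreover have "List.map_filter ?f [j + c..<n + 1] = []"
    using assms by (intro map_filter_None) (auto simp: diag_array_def diag_index_def min_def
        split: if_splits)
  moreover have "List.map_filter ?f [j..<j + c] = map ?h [0..<c]"
  proof -
    have "[j..<j + c] = map (\<lambda>l. j + l) [0..<c]"
      using upt_map_shift[of 0 j 0 c] by simp
    then show ?thesis
      using assms
      by (simp only:)
        (intro map_filter_Some, auto simp: diag_array_def diag_index_def wrapped_row_def)
  qed
  moreover have "List.map_filter ?f [1..<q] = map ?h [c..<k]"
  proof (cases "c < k")
    case True
    then have "n \<le> j + c" "j + c - n = 1" "j + k - n = q"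
      using assms by (auto simp: q_def)
    then have "[1..<q] = map (\<lambda>l. j + l - n) [c..<k]"
      using upt_map_shift[of n j c k] by (simp only:)
    then show ?thesis
      using assms True
      by (simp only:)
        (intro map_filter_Some, auto simp: diag_array_def diag_index_def wrapped_row_def)
  qed (simp add: q_def)
  ultimately show ?thesis
    unfolding col_entries_def by (simp add: map_filter_append comp_def)
qed

section \<open>Block sums in rows and columns\<close>

lemma diag_array_row_sums:
  assumes "i \<in> {1..n}" "1 \<le> k" "k \<le> n"
  shows "simple_ordering (heffter_modulus n k) (row_entries n (diag_array n k) i)"
    and "[sum_list (row_entries n (diag_array n k) i) \<noteq> 0] (mod heffter_modulus n k)"
proof -
  let ?x = "\<lambda>l. int (height n k l i)"
  define r where "r = min i k"
  let ?ys = "map (\<lambda>l. (-1) ^ l * ?x l) ([r..<k] @ [0..<r])"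
  have pos: "0 < ?x l" for l
    using height_bounds(1)[of i n l k] assms(1) by simp
  have mono: "?x l < ?x (Suc l)" for l
    using height_mono[of i n i k l] assms(1) by simp
  \<comment> \<open>In a fixed row consecutive heights differ by \<open>n\<close> on both runs, so
    \<open>s\<close> and \<open>u\<close> agree. A junction exists only if \<open>i < k\<close>,
    which gives \<open>s < N\<close>.\<close>
  have wrap: "alt_sum ?x a k + alt_sum ?x 0 b \<noteq> 0" if "0 < b" "b \<le> r" "r \<le> a" "a < k" for a b
  proof (rule alt_sum_wrap_nonzero[where c = r and s = "int i" and u = "int i" and N = "int n"
        and t = "int (shift n k i)"])
    have ik: "i < k" "r = i"
      using that by (auto simp: r_def)
    show "\<bar>int (shift n k i) - int i\<bar> < int n"
      using shift_range[of i n k] assms(1) by auto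
    show "odd k \<Longrightarrow> int (shift n k i) \<noteq> int i"
      using shift_neq[of k n i] ik assms by simp
    show "even k \<Longrightarrow> int (shift n k i) = int i \<and> int i < int n"
      using ik assms by (simp add: shift_def)
    show "r \<le> l \<Longrightarrow> l < k \<Longrightarrow> ?x l = int l * int n + int i" for l
      using ik assms by (simp add: height_def)
  qed (use that pos mono assms in \<open>auto simp: height_def\<close>)
  have small: "sum_list us \<noteq> 0 \<and> \<bar>sum_list us\<bar> < heffter_modulus n k"
    if "sublist us (rev ?ys)" "us \<noteq> []" for us
  proof -
    \<comment> \<open>A row is read against the diagonal indices; reversing a block does not change
      its sum.\<close>
    have "sum_list (rev us) \<noteq> 0 \<and> \<bar>sum_list (rev us)\<bar> \<le> 2 * int (n * k)"
    proof (rule sum_list_rotated_alternating[where k = k and x = ?x and c = r])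
      show "sublist (rev us) ?ys"
        using that(1) by (simp add: sublist_rev_left del: map_append)
    qed (use that wrap pos mono height_le[OF assms(1)] in \<open>auto simp: r_def simp flip: of_nat_mult\<close>)
    then show ?thesis
      by (simp add: heffter_modulus_def sum_list_rev)
  qed
  have ne: "rev ?ys \<noteq> []"
    using assms by (simp add: r_def)
  have entries: "row_entries n (diag_array n k) i = map (\<lambda>y. y mod heffter_modulus n k) (rev ?ys)"
    unfolding r_def by (rule diag_array_row) (use assms in auto)
  show "simple_ordering (heffter_modulus n k) (row_entries n (diag_array n k) i)"
    and "[sum_list (row_entries n (diag_array n k) i) \<noteq> 0] (mod heffter_modulus n k)"
    unfolding entries using small ne by (intro simple_ordering_of_small_sums; blast)+
qed

lemma diag_array_col_sums:
  assumes "j \<in> {1..n}" "1 \<le> k" "k \<le> n"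
  shows "simple_ordering (heffter_modulus n k) (col_entries n (diag_array n k) j)"
    and "[sum_list (col_entries n (diag_array n k) j) \<noteq> 0] (mod heffter_modulus n k)"
proof -
  let ?x = "\<lambda>l. int (height n k l (wrapped_row n j l))"
  define c where "c = min (n + 1 - j) k"
  let ?ys = "map (\<lambda>l. (-1) ^ l * ?x l) ([c..<k] @ [0..<c])"
  have row: "wrapped_row n j l \<in> {1..n}" if "l < k" for l
    using wrapped_row_range[of j n l] that assms by simp
  have pos: "0 < ?x l" if "l < k" for l
    using height_bounds(1)[OF row[OF that], of l k] by simp
  have mono: "?x l < ?x (Suc l)" if "Suc l < k" for l
    using height_mono[OF row row, of l "Suc l" k l] that by simp
  \<comment> \<open>Down a column each diagonal adds \<open>n\<close> and each new row adds 1, so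
    the slope is \<open>n + 1\<close>. Wrapping lowers the row by \<open>n\<close>, which gives
    \<open>u = j - n\<close> and \<open>s - u = n\<close>, just below the slope.\<close>
  have wrap: "alt_sum ?x a k + alt_sum ?x 0 b \<noteq> 0" if "0 < b" "b \<le> c" "c \<le> a" "a < k" for a b
  proof (rule alt_sum_wrap_nonzero[where c = c and s = "int j" and u = "int j - int n"
        and N = "int n + 1" and t = "int (shift n k j)"])
    have ck: "c = n + 1 - j" "c < k"
      using that by (auto simp: c_def)
    \<comment> \<open>In size 1 the cyclic successor would fix the only row; a junction rules this
      out.\<close>
    then have n: "2 \<le> n"
      using assms by auto
    show "\<bar>int (shift n k j) - int j\<bar> < int n + 1"
      using shift_range[of j n k] assms(1) by auto
    show "odd k \<Longrightarrow> int (shift n k j) \<noteq> int j"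
      using shift_neq[of k n j] n assms by simp
    show "even k \<Longrightarrow> int (shift n k j) = int j \<and> int j < int n + 1"
      using assms by (simp add: shift_def)
    show "0 < l \<Longrightarrow> l < c \<Longrightarrow> ?x l = int l * (int n + 1) + int j" for l
      using ck assms by (simp add: height_def wrapped_row_def algebra_simps)
    show "c \<le> l \<Longrightarrow> l < k \<Longrightarrow> ?x l = int l * (int n + 1) + (int j - int n)" for l
      using ck assms by (auto simp: height_def wrapped_row_def algebra_simps)
  qed (use that pos mono assms in \<open>auto simp: height_def wrapped_row_def\<close>)
  have small: "sum_list us \<noteq> 0 \<and> \<bar>sum_list us\<bar> < heffter_modulus n k"
    if "sublist us ?ys" "us \<noteq> []" for us
  proof -
    have "sum_list us \<noteq> 0 \<and> \<bar>sum_list us\<bar> \<le> 2 * int (n * k)"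
      by (rule sum_list_rotated_alternating[where k = k and x = ?x and c = c])
        (use that wrap pos mono height_le[OF row] in \<open>auto simp: c_def simp flip: of_nat_mult\<close>)
    then show ?thesis
      by (simp add: heffter_modulus_def)
  qed
  have ne: "?ys \<noteq> []"
    using assms by (simp add: c_def)
  have entries: "col_entries n (diag_array n k) j = map (\<lambda>y. y mod heffter_modulus n k) ?ys"
    unfolding c_def by (rule diag_array_col) (use assms in auto)
  show "simple_ordering (heffter_modulus n k) (col_entries n (diag_array n k) j)"
    and "[sum_list (col_entries n (diag_array n k) j) \<noteq> 0] (mod heffter_modulus n k)"
    unfolding entries using small ne by (intro simple_ordering_of_small_sums; blast)+
qed

section \<open>The entries up to sign, and the diagonal shape\<close>

lemma filled_cells_diag_array:
  "filled_cells (diag_array n k) = {(i, j) \<in> {1..n} \<times> {1..n}. diag_index n i j < k}"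
  by (auto simp: filled_cells_def diag_array_def)

lemma square_pf_array_diag_array: "square_pf_array n (diag_array n k)"
  by (auto simp: square_pf_array_def filled_cells_diag_array)

text \<open>The window of a height determines the diagonal, its position in the window determines
  the row because \<open>shift\<close> permutes the rows, and the two together determine the
  column.\<close>

lemma height_bij:
  assumes "k \<le> n"
  shows "bij_betw (\<lambda>(i, j). height n k (diag_index n i j) i) (filled_cells (diag_array n k)) {1..n * k}"
proof (rule bij_betw_imageI)
  let ?F = "filled_cells (diag_array n k)"
  let ?g = "\<lambda>(i, j). height n k (diag_index n i j) i"
  show "inj_on ?g ?F"
  proof (rule inj_onI, clarify)
    fix i j i' j'
    assume cells: "(i, j) \<in> ?F" "(i', j') \<in> ?F"
      and eq: "height n k (diag_index n i j) i = height n k (diag_index n i' j') i'"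
    define l where "l = diag_index n i j"
    define l' where "l' = diag_index n i' j'"
    have range: "i \<in> {1..n}" "j \<in> {1..n}" "i' \<in> {1..n}" "j' \<in> {1..n}"
      using cells by (auto simp: filled_cells_diag_array)
    \<comment> \<open>A common height lies in both windows, which forces the windows to
      coincide.\<close>
    have "l * n < Suc l' * n" "l' * n < Suc l * n"
      using height_bounds(1)[OF range(1), of l k] height_bounds(2)[OF range(1), of k l]
        height_bounds(1)[OF range(3), of l' k] height_bounds(2)[OF range(3), of k l'] eq
      by (simp_all add: l_def l'_def)
    then have l: "l = l'"
      by (metis less_Suc_eq_le mult_less_cancel2 order_antisym)
    have "i = i'"
      using eq shift_inj[OF range(1,3)]
      by (auto simp: height_def l[unfolded l_def l'_def] split: if_splits)
    moreover have "j = j'"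
      using l range \<open>i = i'\<close> by (auto simp: l_def l'_def diag_index_def split: if_splits)
    ultimately show "i = i' \<and> j = j'"
      by simp
  qed
  show "?g ` ?F = {1..n * k}"
  proof (intro subset_antisym subsetI)
    fix z
    assume "z \<in> ?g ` ?F"
    then obtain i j where "i \<in> {1..n}" "diag_index n i j < k" "z = height n k (diag_index n i j) i"
      by (auto simp: filled_cells_diag_array)
    then show "z \<in> {1..n * k}"
      using height_bounds(1)[of i n "diag_index n i j" k] height_le[of i n "diag_index n i j" k]
      by auto
  next
    fix z
    assume z: "z \<in> {1..n * k}"
    then have n: "0 < n"
      by (cases n) auto
    \<comment> \<open>Windows start at \<open>l * n + 1\<close>, so the division is applied to
      \<open>z - 1\<close>.\<close>
    define l where "l = (z - 1) div n"
    define r where "r = (z - 1) mod n + 1"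
    have "z - 1 < k * n"
      using z by (auto simp: mult.commute)
    then have l: "l < k"
      by (simp add: l_def less_mult_imp_div_less)
    have r: "r \<in> {1..n}"
      using n by (auto simp: r_def Suc_le_eq)
    have zlr: "z = l * n + r"
      using z by (simp add: l_def r_def)
    obtain i where i: "i \<in> {1..n}" "height n k l i = z"
    proof (cases "l = 0")
      case True
      obtain i where "i \<in> {1..n}" "shift n k i = r"
        using shift_surj[OF r] .
      then show ?thesis
        using that[of i] zlr True by (simp add: height_def)
    next
      case False
      then show ?thesis
        using that[of r] zlr r by (simp add: height_def)
    qed
    define j where "j = (if l < i then i - l else i + n - l)"
    have "j \<in> {1..n}" "diag_index n i j = l"
      using i(1) l assms by (auto simp: j_def diag_index_def)
    then show "z \<in> ?g ` ?F"
      using i l by (intro image_eqI[of _ _ "(i, j)"]) (auto simp: filled_cells_diag_array)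
  qed
qed

text \<open>Whatever the sign, the pair consists of \<open>a\<close> and \<open>v - a\<close>, and
  \<open>a\<close> is the smaller one. So \<open>x\<close> occurs exactly when \<open>a\<close> is
  the smaller of \<open>x\<close> and \<open>v - x\<close>, and then only once.\<close>

lemma count_pm_pair:
  fixes a v x :: int
  assumes "0 < a" "2 * a < v" "0 < x" "x < v"
  shows "count {#(-1) ^ l * a mod v, (- ((-1) ^ l * a mod v)) mod v#} x =
    (if a = min x (v - x) then 1 else 0)"
proof -
  have "a mod v = a" "(- a) mod v = v - a"
    using assms by (simp_all add: zmod_zminus1_eq_if)
  then show ?thesis
    using assms by (cases "even l") (auto simp: mod_minus_eq min_def)
qed

text \<open>The smaller of \<open>x\<close> and its negative lies in \<open>{1..n * k}\<close>, and
  by \<open>height_bij\<close> it is the height of exactly one cell, the only one contributing to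
  the count.\<close>

lemma count_pm_entries_diag_array:
  assumes "k \<le> n" "x \<in> {0..<heffter_modulus n k} - {0}"
  shows "count (pm_entries (heffter_modulus n k) (diag_array n k)) x = 1"
proof -
  let ?F = "filled_cells (diag_array n k)"
  let ?v = "heffter_modulus n k"
  let ?g = "\<lambda>(i, j). height n k (diag_index n i j) i"
  define z where "z = nat (min x (?v - x))"
  have v: "?v = 2 * int (n * k) + 1"
    by (simp add: heffter_modulus_def)
  have z: "z \<in> {1..n * k}" "int z = min x (?v - x)"
    using assms by (auto simp: z_def v min_def nat_le_iff simp del: of_nat_mult)
  have "count (pm_entries ?v (diag_array n k)) x =
    (\<Sum>p\<in>?F. count (case p of (i, j) \<Rightarrow>
        {#the (diag_array n k i j), (- the (diag_array n k i j)) mod ?v#}) x)"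
    by (simp add: pm_entries_def count_sum)
  also have "\<dots> = (\<Sum>p\<in>?F. if ?g p = z then 1 else 0)"
  proof (rule sum.cong[OF refl], clarify)
    fix i j
    assume ij: "(i, j) \<in> ?F"
    let ?l = "diag_index n i j"
    have "?g (i, j) \<in> {1..n * k}"
      using height_bij[OF assms(1)] ij by (auto simp: bij_betw_def simp del: case_prod_conv)
    then have "0 < int (height n k ?l i)" "2 * int (height n k ?l i) < ?v"
      by (auto simp: v simp del: of_nat_mult)
    then have "count {#(-1) ^ ?l * int (height n k ?l i) mod ?v,
        (- ((-1) ^ ?l * int (height n k ?l i) mod ?v)) mod ?v#} x
      = (if int (height n k ?l i) = int z then 1 else 0)"
      using assms z(2) by (subst count_pm_pair) auto
    moreover have "the (diag_array n k i j) = (-1) ^ ?l * int (height n k ?l i) mod ?v"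
      using ij by (auto simp: filled_cells_diag_array diag_array_def)
    ultimately show "count {#the (diag_array n k i j), (- the (diag_array n k i j)) mod ?v#} x =
        (if height n k ?l i = z then 1 else 0)"
      by simp
  qed
  also have "\<dots> = (\<Sum>y\<in>{1..n * k}. if y = z then 1 else 0)"
    by (rule sum.reindex_bij_betw[OF height_bij[OF assms(1)]])
  also have "\<dots> = 1"
    using z(1) by simp
  finally show ?thesis .
qed

text \<open>Allows the number of filled cells of a row or column to be read off its explicit list of
  entries.\<close>

lemma card_filled_eq_length:
  "card {j \<in> {1..n}. f j \<noteq> None} = length (List.map_filter f [1..<n + 1])"
proof -
  have "{j \<in> {1..n}. f j \<noteq> None} = set (filter (\<lambda>j. f j \<noteq> None) [1..<n + 1])"
    by auto
  then show ?thesis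
    by (simp only: distinct_card distinct_filter distinct_upt List.map_filter_def length_map)
qed

text \<open>The diagonals start at the main one, number 1; in each column \<open>wrapped_row\<close>
  and \<open>diag_index\<close> translate between rows and diagonal indices.\<close>

lemma cyclically_diagonal_diag_array:
  assumes "1 \<le> k" "k \<le> n"
  shows "cyclically_diagonal n k (diag_array n k)"
proof -
  \<comment> \<open>Since \<open>l < n\<close>, the inner \<open>wrap_index\<close> changes nothing
    and the outer one subtracts \<open>n\<close> at most once.\<close>
  have wrap: "wrap_index n (wrap_index n (1 + l) + j - 1) = wrapped_row n j l"
    if "l < k" "j \<in> {1..n}" for l j
    using that assms by (auto simp: wrap_index_def wrapped_row_def mod_if)
  have diag: "diagonal n (wrap_index n (1 + l)) = (\<lambda>j. (wrapped_row n j l, j)) ` {1..n}"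
    if "l < k" for l
    unfolding diagonal_def using wrap[OF that] by (intro image_cong) auto
  have "filled_cells (diag_array n k) = (\<Union>l<k. (\<lambda>j. (wrapped_row n j l, j)) ` {1..n})"
  proof (intro subset_antisym subsetI)
    fix p
    assume "p \<in> filled_cells (diag_array n k)"
    then obtain i j where p: "p = (i, j)" "i \<in> {1..n}" "j \<in> {1..n}" "diag_index n i j < k"
      by (auto simp: filled_cells_diag_array)
    then have "wrapped_row n j (diag_index n i j) = i"
      by (auto simp: wrapped_row_def diag_index_def)
    then show "p \<in> (\<Union>l<k. (\<lambda>j. (wrapped_row n j l, j)) ` {1..n})"
      using p by force
  next
    fix p
    assume "p \<in> (\<Union>l<k. (\<lambda>j. (wrapped_row n j l, j)) ` {1..n})"
    then obtain l j where p: "p = (wrapped_row n j l, j)" "l < k" "j \<in> {1..n}"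
      by auto
    then have "diag_index n (wrapped_row n j l) j = l"
      using assms by (auto simp: wrapped_row_def diag_index_def)
    then show "p \<in> filled_cells (diag_array n k)"
      using p wrapped_row_range[of j n l] assms by (auto simp: filled_cells_diag_array)
  qed
  also have "\<dots> = (\<Union>l<k. diagonal n (wrap_index n (1 + l)))"
    using diag by simp
  finally have "filled_cells (diag_array n k) = (\<Union>l<k. diagonal n (wrap_index n (1 + l)))" .
  moreover have "1 \<in> {1..n}"
    using assms by simp
  ultimately show ?thesis
    unfolding cyclically_diagonal_def using square_pf_array_diag_array by blast
qed

theorem theorem5p2:
  fixes n k :: nat
  assumes "1 \<le> k" and "k \<le> n"
  shows "\<exists>A :: int pf_array.
    nonzero_sum_heffter n k A \<and>
    globally_simple (heffter_modulus n k) n A \<and>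
    cyclically_diagonal n k A"
proof (intro exI conjI)
  let ?A = "diag_array n k"
  have v: "0 < heffter_modulus n k"
    by (simp add: heffter_modulus_def)
  have "card {j \<in> {1..n}. ?A i j \<noteq> None} = k" if "i \<in> {1..n}" for i
    using diag_array_row[OF that \<open>k \<le> n\<close>]
    unfolding card_filled_eq_length row_entries_def by simp
  moreover have "card {i \<in> {1..n}. ?A i j \<noteq> None} = k" if "j \<in> {1..n}" for j
    using diag_array_col[OF that \<open>k \<le> n\<close>]
    unfolding card_filled_eq_length col_entries_def by simp
  moreover have "the (?A i j) \<in> {0..<heffter_modulus n k}" if "(i, j) \<in> filled_cells ?A" for i j
    using that v by (auto simp: filled_cells_diag_array diag_array_def)
  ultimately show "nonzero_sum_heffter n k ?A"
    using square_pf_array_diag_array diag_array_row_sums(2) diag_array_col_sums(2)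
      count_pm_entries_diag_array assms
    unfolding nonzero_sum_heffter_def by blast
  show "globally_simple (heffter_modulus n k) n ?A"
    using diag_array_row_sums(1) diag_array_col_sums(1) assms by (simp add: globally_simple_def)
  show "cyclically_diagonal n k ?A"
    using cyclically_diagonal_diag_array assms by simp
qed

end
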